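(* Let $r>0$ and $A\in\mathrm{GL}(2,\mathbb{R})$. There exists $s_0$ such that for all $s\ge s_0$, for every $\Gamma\in\mathcal{H}$ and every non-empty compact $K\subseteq\mathbb{R}^2$ with $K\in\mathcal{LA}_s(\Gamma)$, we have $A(K)\in\mathcal{LA}_r(A(\Gamma))$.
   Context: $d_H$ is the Hausdorff distance. $\mathcal{H}$ is the set of homothety types: non-empty compact subsets of $\mathbb{R}^2$ modulo the group generated by translations and homotheties of positive ratio; $A(\Gamma)$ is the homothety type of $A(\hat\Gamma)$ for any $\hat\Gamma\in\Gamma$. For $r>0$, $\Gamma\in\mathcal{H}$ and non-empty compact $K$, $K\in\mathcal{LA}_r(\Gamma)$ ($K$ is an $r$-large approximate of $\Gamma$) means $\mathrm{diam}(K)>r$ and there is $\hat\Gamma\in\Gamma$ of diameter $1$ with $d_H(K/\mathrm{diam}(K),\hat\Gamma)<1/r$. *)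

theory Defs
  imports "HOL-Analysis.Analysis"
begin

text \<open>Hausdorff distance (meaningful for non-empty bounded sets; used here only for
non-empty compact ones).\<close>
definition hausdorff_dist :: "'a::metric_space set \<Rightarrow> 'a set \<Rightarrow> real" where
  "hausdorff_dist S T = max (SUP x\<in>S. setdist {x} T) (SUP y\<in>T. setdist {y} S)"

text \<open>T is the image of S under a map of the group generated by translations and
homotheties of positive ratio, i.e. a map x \<mapsto> c x + v with c > 0.\<close>
definition homothetic :: "(real^2) set \<Rightarrow> (real^2) set \<Rightarrow> bool" where
  "homothetic S T \<longleftrightarrow> (\<exists>c>0. \<exists>v. T = (\<lambda>x. c *\<^sub>R x + v) ` S)"

definition homothety_class :: "(real^2) set \<Rightarrow> (real^2) set set" where
  "homothety_class S = {T. homothetic S T}"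

text \<open>The set \<H> of homothety types.\<close>
definition homothety_types :: "(real^2) set set set" where
  "homothety_types = {homothety_class S | S. S \<noteq> {} \<and> compact S}"

text \<open>A(\<Gamma>): apply the linear map to every member of the class.\<close>
definition type_image :: "real^2^2 \<Rightarrow> (real^2) set set \<Rightarrow> (real^2) set set" where
  "type_image A \<Gamma> = (\<lambda>S. (\<lambda>x. A *v x) ` S) ` \<Gamma>"

text \<open>K is an r-large approximate of \<Gamma>.\<close>
definition large_approx :: "real \<Rightarrow> (real^2) set set \<Rightarrow> (real^2) set \<Rightarrow> bool" where
  "large_approx r \<Gamma> K \<longleftrightarrow> diameter K > r \<and>
     (\<exists>G\<in>\<Gamma>. diameter G = 1 \<and>
        hausdorff_dist ((\<lambda>x. (1 / diameter K) *\<^sub>R x) ` K) G < 1 / r)"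

end

(* A linear isomorphism f with m |x| <= |f x| <= M |x| moves every point, and hence distorts
   Hausdorff distances and diameters, by at most a bounded factor.  If K/diam K is 1/s-close to
   a unit-diameter representative G of the type, then f K/diam(f K) is O(M/(m s))-close to a
   suitably rescaled copy of f G, which represents A(Gamma).  Meanwhile
   diam(f K) >= m diam K grows with s. *)
theory Submission
  imports Defs
begin

definition hausdorff_close :: "real \<Rightarrow> 'a::metric_space set \<Rightarrow> 'a set \<Rightarrow> bool" where
  "hausdorff_close d S T \<longleftrightarrow>
     (\<forall>x\<in>S. \<exists>y\<in>T. dist x y \<le> d) \<and> (\<forall>y\<in>T. \<exists>x\<in>S. dist x y \<le> d)"

lemma hausdorff_close_commute: "hausdorff_close d S T \<longleftrightarrow> hausdorff_close d T S"
  unfolding hausdorff_close_def by (auto simp: dist_commute)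

lemma hausdorff_close_mono: "hausdorff_close d S T \<Longrightarrow> d \<le> e \<Longrightarrow> hausdorff_close e S T"
  unfolding hausdorff_close_def by (meson order_trans)

lemma hausdorff_dist_commute: "hausdorff_dist S T = hausdorff_dist T S"
  unfolding hausdorff_dist_def by (simp add: max.commute)

lemma hausdorff_dist_le:
  assumes "S \<noteq> {}" "T \<noteq> {}" "hausdorff_close d S T"
  shows "hausdorff_dist S T \<le> d"
  unfolding hausdorff_dist_def
proof (rule max.boundedI)
  show "(SUP x\<in>S. setdist {x} T) \<le> d"
  proof (rule cSUP_least)
    fix x assume "x \<in> S"
    with assms(3) obtain y where "y \<in> T" "dist x y \<le> d" unfolding hausdorff_close_def by blast
    then show "setdist {x} T \<le> d" using setdist_le_dist[of x "{x}" y T] by simp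
  qed (fact assms(1))
  show "(SUP y\<in>T. setdist {y} S) \<le> d"
  proof (rule cSUP_least)
    fix y assume "y \<in> T"
    with assms(3) obtain x where "x \<in> S" "dist x y \<le> d" unfolding hausdorff_close_def by blast
    then show "setdist {y} S \<le> d" using setdist_le_dist[of y "{y}" x S] by (simp add: dist_commute)
  qed (fact assms(2))
qed

lemma setdist_le_hausdorff_dist:
  assumes "bounded S" "T \<noteq> {}" "x \<in> S"
  shows "setdist {x} T \<le> hausdorff_dist S T"
proof -
  obtain t where t: "t \<in> T" using assms(2) by blast
  obtain e where e: "\<And>z. z \<in> S \<Longrightarrow> dist t z \<le> e"
    using bounded_any_center[of S t] assms(1) by blast
  have "setdist {z} T \<le> e" if "z \<in> S" for z
    using setdist_le_dist[of z "{z}" t T] t e[OF that] by (simp add: dist_commute)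
  then have "bdd_above ((\<lambda>z. setdist {z} T) ` S)" by (rule bdd_aboveI2)
  then have "setdist {x} T \<le> (SUP z\<in>S. setdist {z} T)" by (rule cSUP_upper[OF assms(3)])
  then show ?thesis unfolding hausdorff_dist_def by linarith
qed

lemma hausdorff_close_if_hausdorff_dist_less:
  assumes "bounded S" "bounded T" "S \<noteq> {}" "T \<noteq> {}" "hausdorff_dist S T < d"
  shows "hausdorff_close d S T"
proof -
  have near: "\<exists>y\<in>T. dist x y \<le> d"
    if h: "bounded S" "T \<noteq> {}" "x \<in> S" "hausdorff_dist S T < d" for S T and x :: 'a
  proof -
    have "setdist {x} T < d" using setdist_le_hausdorff_dist[OF h(1-3)] h(4) by linarith
    then obtain x' y where "x' \<in> {x}" "y \<in> T" "dist x' y < d"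
      using setdist_ltE[of "{x}" T d] h(2) by blast
    then show ?thesis by (auto intro: less_imp_le)
  qed
  have "\<exists>x\<in>S. dist x y \<le> d" if "y \<in> T" for y
    using near[OF assms(2,3) that] assms(5) by (simp add: hausdorff_dist_commute dist_commute)
  then show ?thesis
    unfolding hausdorff_close_def using near[OF assms(1,4) _ assms(5)] by blast
qed

lemma hausdorff_close_image:
  assumes "L-lipschitz_on UNIV f" "hausdorff_close d S T"
  shows "hausdorff_close (L * d) (f ` S) (f ` T)"
proof -
  have "dist (f x) (f y) \<le> L * d" if "dist x y \<le> d" for x y
  proof -
    have "dist (f x) (f y) \<le> L * dist x y" using lipschitz_onD[OF assms(1)] by blast
    also have "\<dots> \<le> L * d" using that lipschitz_on_nonneg[OF assms(1)] by (rule mult_left_mono)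
    finally show ?thesis .
  qed
  then show ?thesis using assms(2) unfolding hausdorff_close_def by blast
qed

lemma diameter_le_hausdorff_close:
  fixes S T :: "'a::real_normed_vector set"
  assumes "bounded T" "S \<noteq> {}" "hausdorff_close d S T"
  shows "diameter S \<le> diameter T + 2 * d"
proof (rule diameter_le)
  fix x x' assume "x \<in> S" "x' \<in> S"
  with assms(3) obtain y y' where "y \<in> T" "y' \<in> T" "dist x y \<le> d" "dist x' y' \<le> d"
    unfolding hausdorff_close_def by blast
  moreover from this have "dist y y' \<le> diameter T" using diameter_bounded_bound[OF assms(1)] by blast
  moreover have "dist x x' \<le> dist x y + dist y y' + dist x' y'"
    using dist_triangle[of x x' y] dist_triangle[of y x' y'] by (simp add: dist_commute)
  ultimately show "norm (x - x') \<le> diameter T + 2 * d" by (simp add: dist_norm)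
qed (use assms(2) in auto)

lemma diameter_image_le:
  fixes f :: "'a::metric_space \<Rightarrow> 'b::real_normed_vector"
  assumes "L-lipschitz_on S f" "bounded S"
  shows "diameter (f ` S) \<le> L * diameter S"
proof (rule diameter_le)
  fix u v assume "u \<in> f ` S" "v \<in> f ` S"
  then obtain x y where xy: "x \<in> S" "y \<in> S" "u = f x" "v = f y" by blast
  have "dist (f x) (f y) \<le> L * dist x y" using lipschitz_onD[OF assms(1) xy(1,2)] .
  also have "\<dots> \<le> L * diameter S"
    using diameter_bounded_bound[OF assms(2) xy(1,2)] lipschitz_on_nonneg[OF assms(1)]
    by (rule mult_left_mono)
  finally show "norm (u - v) \<le> L * diameter S" using xy by (simp add: dist_norm)
qed (use lipschitz_on_nonneg[OF assms(1)] diameter_ge_0[OF assms(2)] in simp)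

lemma diameter_image_ge:
  fixes S :: "'a::real_normed_vector set" and f :: "'a \<Rightarrow> 'b::metric_space"
  assumes "bounded (f ` S)" "m > 0"
    and "\<And>x y. x \<in> S \<Longrightarrow> y \<in> S \<Longrightarrow> m * dist x y \<le> dist (f x) (f y)"
  shows "m * diameter S \<le> diameter (f ` S)"
proof -
  have "diameter S \<le> diameter (f ` S) / m"
  proof (rule diameter_le)
    fix x y assume xy: "x \<in> S" "y \<in> S"
    have "dist (f x) (f y) \<le> diameter (f ` S)"
      using diameter_bounded_bound[OF assms(1)] xy by blast
    then have "m * dist x y \<le> diameter (f ` S)" using assms(3)[OF xy] by linarith
    then show "norm (x - y) \<le> diameter (f ` S) / m"
      using assms(2) by (simp add: field_simps dist_norm)
  qed (use diameter_ge_0[OF assms(1)] assms(2) in simp)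
  then show ?thesis using assms(2) by (simp add: field_simps)
qed

lemma bounded_affine_image:
  fixes S :: "'a::real_normed_vector set"
  assumes "bounded S"
  shows "bounded ((\<lambda>x. c *\<^sub>R x + w) ` S)"
proof -
  have "(\<lambda>x. c *\<^sub>R x + w) ` S = (\<lambda>x. w + x) ` (\<lambda>x. c *\<^sub>R x) ` S"
    by (simp add: image_image add.commute)
  then show ?thesis using assms by (simp add: bounded_translation bounded_scaling)
qed

lemma diameter_affine_image:
  fixes S :: "'a::real_normed_vector set"
  assumes "bounded S" "c > 0"
  shows "diameter ((\<lambda>x. c *\<^sub>R x + w) ` S) = c * diameter S"
proof -
  have dist_eq: "dist (c *\<^sub>R x + w) (c *\<^sub>R y + w) = c * dist x y" for x y
  proof -
    have "(c *\<^sub>R x + w) - (c *\<^sub>R y + w) = c *\<^sub>R (x - y)" by (simp add: algebra_simps)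
    then show ?thesis using assms(2) by (simp add: dist_norm)
  qed
  have "c-lipschitz_on S (\<lambda>x. c *\<^sub>R x + w)"
    using assms(2) by (intro lipschitz_onI) (simp_all only: dist_eq order_refl less_imp_le)
  then have "diameter ((\<lambda>x. c *\<^sub>R x + w) ` S) \<le> c * diameter S"
    using assms(1) by (rule diameter_image_le)
  moreover have "c * diameter S \<le> diameter ((\<lambda>x. c *\<^sub>R x + w) ` S)"
    using bounded_affine_image[OF assms(1)] assms(2) by (rule diameter_image_ge) (simp only: dist_eq order_refl)
  ultimately show ?thesis by (rule order_antisym)
qed

lemma normalized_scaleR_image:
  fixes S :: "'a::real_normed_vector set"
  assumes "bounded S" "c > 0"
  shows "(\<lambda>x. (1 / diameter ((\<lambda>x. c *\<^sub>R x) ` S)) *\<^sub>R x) ` (\<lambda>x. c *\<^sub>R x) ` S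
       = (\<lambda>x. (1 / diameter S) *\<^sub>R x) ` S"
  using diameter_affine_image[OF assms, of 0] assms(2) by (simp add: image_image)

text \<open>Rescaling Y about one of its own points p is what makes this work: all of Y lies within
  diameter Y of p, so the mismatch between the two scale factors costs only
  |diameter Y - diameter X| / diameter X.\<close>
lemma hausdorff_close_normalized:
  fixes X Y :: "'a::real_normed_vector set"
  assumes "bounded X" "bounded Y" "p \<in> Y" "diameter X > 0" "diameter Y > 0"
    and "hausdorff_close \<delta> X Y"
  shows "hausdorff_close (3 * \<delta> / diameter X) ((\<lambda>x. (1 / diameter X) *\<^sub>R x) ` X)
           ((\<lambda>y. (1 / diameter Y) *\<^sub>R y + (1 / diameter X - 1 / diameter Y) *\<^sub>R p) ` Y)"
proof -
  define a b where "a = diameter X" and "b = diameter Y"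
  have "X \<noteq> {}" using assms(4) by (metis diameter_empty less_irrefl)
  moreover have "Y \<noteq> {}" using assms(3) by blast
  ultimately have ab: "\<bar>b - a\<bar> \<le> 2 * \<delta>"
    using diameter_le_hausdorff_close[OF assms(2) _ assms(6)]
      diameter_le_hausdorff_close[OF assms(1) _ hausdorff_close_commute[THEN iffD1, OF assms(6)]]
    unfolding a_def b_def by linarith
  have key: "dist ((1 / a) *\<^sub>R x) ((1 / b) *\<^sub>R y + (1 / a - 1 / b) *\<^sub>R p) \<le> 3 * \<delta> / a"
    if "y \<in> Y" "dist x y \<le> \<delta>" for x y
  proof -
    have "(1 / a) *\<^sub>R x - ((1 / b) *\<^sub>R y + (1 / a - 1 / b) *\<^sub>R p)
        = (1 / a) *\<^sub>R (x - y) + (1 / a - 1 / b) *\<^sub>R (y - p)"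
      by (simp add: algebra_simps)
    moreover have "norm ((1 / a) *\<^sub>R (x - y)) \<le> \<delta> / a"
      using that(2) assms(4) unfolding a_def by (simp add: dist_norm divide_right_mono)
    moreover have "norm ((1 / a - 1 / b) *\<^sub>R (y - p)) \<le> 2 * \<delta> / a"
    proof -
      have "norm (y - p) \<le> b"
        using diameter_bounded_bound[OF assms(2) that(1) assms(3)] unfolding b_def by (simp add: dist_norm)
      then have "norm ((1 / a - 1 / b) *\<^sub>R (y - p)) \<le> \<bar>1 / a - 1 / b\<bar> * b"
        by (simp add: mult_left_mono)
      also have "\<dots> = \<bar>b - a\<bar> / a"
        using assms(4,5) unfolding a_def b_def by (simp add: field_simps abs_div)
      also have "\<dots> \<le> 2 * \<delta> / a" using ab assms(4) unfolding a_def by (simp add: divide_right_mono)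
      finally show ?thesis .
    qed
    ultimately show ?thesis
      using norm_triangle_ineq[of "(1 / a) *\<^sub>R (x - y)" "(1 / a - 1 / b) *\<^sub>R (y - p)"]
      by (simp add: dist_norm)
  qed
  have "\<exists>y'\<in>(\<lambda>y. (1 / b) *\<^sub>R y + (1 / a - 1 / b) *\<^sub>R p) ` Y. dist ((1 / a) *\<^sub>R x) y' \<le> 3 * \<delta> / a"
    if "x \<in> X" for x
    using assms(6) that key unfolding hausdorff_close_def by blast
  moreover have "\<exists>x'\<in>(\<lambda>x. (1 / a) *\<^sub>R x) ` X. dist x' ((1 / b) *\<^sub>R y + (1 / a - 1 / b) *\<^sub>R p) \<le> 3 * \<delta> / a"
    if "y \<in> Y" for y
    using assms(6) that key unfolding hausdorff_close_def by blast
  ultimately show ?thesis unfolding hausdorff_close_def a_def b_def by blast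
qed

lemma homothety_class_affine_image:
  assumes "T \<in> homothety_class S" "c > 0"
  shows "(\<lambda>x. c *\<^sub>R x + w) ` T \<in> homothety_class S"
proof -
  obtain c' v where "c' > 0" "T = (\<lambda>x. c' *\<^sub>R x + v) ` S"
    using assms(1) unfolding homothety_class_def homothetic_def by blast
  then have "(\<lambda>x. c *\<^sub>R x + w) ` T = (\<lambda>x. (c * c') *\<^sub>R x + (c *\<^sub>R v + w)) ` S"
    by (auto simp: image_image algebra_simps)
  moreover have "c * c' > 0" using \<open>c' > 0\<close> assms(2) by simp
  ultimately show ?thesis unfolding homothety_class_def homothetic_def by blast
qed

lemma compact_homothety_class:
  assumes "T \<in> homothety_class S" "compact S"
  shows "compact T"
proof -
  obtain c v where "T = (\<lambda>x. c *\<^sub>R x + v) ` S"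
    using assms(1) unfolding homothety_class_def homothetic_def by blast
  then show ?thesis
    using assms(2) by (auto intro!: compact_continuous_image continuous_intros)
qed

lemma linear_image_affine_image:
  assumes "linear f"
  shows "f ` (\<lambda>x. c *\<^sub>R x + w) ` S = (\<lambda>y. c *\<^sub>R y + f w) ` f ` S"
  by (simp add: image_image linear_add[OF assms] linear_scale[OF assms])

lemma linear_image_normalized_close:
  fixes f :: "'a::real_normed_vector \<Rightarrow> 'b::real_normed_vector"
  assumes f: "bounded_linear f" "M-lipschitz_on UNIV f" "m > 0"
    "\<And>x y. m * dist x y \<le> dist (f x) (f y)"
    and K: "bounded K" "diameter K > 0"
    and G: "bounded G" "p \<in> G" "diameter G = 1"
    and close: "hausdorff_close \<epsilon> ((\<lambda>x. (1 / diameter K) *\<^sub>R x) ` K) G"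
  obtains c w where "c > 0" "diameter (f ` (\<lambda>x. c *\<^sub>R x + w) ` G) = 1"
    "hausdorff_close (3 * M * \<epsilon> / m) ((\<lambda>x. (1 / diameter (f ` K)) *\<^sub>R x) ` f ` K)
       (f ` (\<lambda>x. c *\<^sub>R x + w) ` G)"
proof -
  define K' where "K' = (\<lambda>x. (1 / diameter K) *\<^sub>R x) ` K"
  define a b where "a = diameter (f ` K')" and "b = diameter (f ` G)"
  have lin: "linear f" using f(1) by (rule bounded_linear.linear)
  have "bounded K'" unfolding K'_def using K(1) by (rule bounded_scaling)
  have "diameter K' = 1"
    using diameter_affine_image[OF K(1), of "1 / diameter K" 0] K(2) unfolding K'_def by simp
  then have a: "a \<ge> m"
    using diameter_image_ge[OF bounded_linear_image[OF \<open>bounded K'\<close> f(1)] f(3) f(4)]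
    unfolding a_def by simp
  have b: "b \<ge> m"
    using diameter_image_ge[OF bounded_linear_image[OF G(1) f(1)] f(3) f(4)] G(3) unfolding b_def by simp
  have fK': "f ` K' = (\<lambda>x. (1 / diameter K) *\<^sub>R x) ` f ` K"
    unfolding K'_def using linear_image_affine_image[OF lin, of "1 / diameter K" 0] by (simp add: linear_0[OF lin])
  have "hausdorff_close (M * \<epsilon>) (f ` K') (f ` G)"
    using hausdorff_close_image[OF f(2) close] unfolding K'_def .
  then have close_fK: "hausdorff_close (3 * (M * \<epsilon>) / a) ((\<lambda>x. (1 / a) *\<^sub>R x) ` f ` K')
      ((\<lambda>y. (1 / b) *\<^sub>R y + (1 / a - 1 / b) *\<^sub>R f p) ` f ` G)"
    using hausdorff_close_normalized[of "f ` K'" "f ` G" "f p"] a b f(3) G(2)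
      bounded_linear_image[OF \<open>bounded K'\<close> f(1)] bounded_linear_image[OF G(1) f(1)]
    unfolding a_def b_def by simp
  show ?thesis
  proof
    show "1 / b > 0" using b f(3) by simp
    show "diameter (f ` (\<lambda>x. (1 / b) *\<^sub>R x + (1 / a - 1 / b) *\<^sub>R p) ` G) = 1"
      using diameter_affine_image[OF bounded_linear_image[OF G(1) f(1)], of "1 / b"] b f(3)
      unfolding linear_image_affine_image[OF lin] b_def by simp
    obtain x where "dist x p \<le> \<epsilon>" using close G(2) unfolding hausdorff_close_def by blast
    then have "\<epsilon> \<ge> 0" using zero_le_dist[of x p] by linarith
    then have "M * \<epsilon> \<ge> 0" using lipschitz_on_nonneg[OF f(2)] by simp
    then have "3 * (M * \<epsilon>) / a \<le> 3 * M * \<epsilon> / m"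
      using a f(3) by (simp add: frac_le)
    with close_fK have "hausdorff_close (3 * M * \<epsilon> / m) ((\<lambda>x. (1 / a) *\<^sub>R x) ` f ` K')
        ((\<lambda>y. (1 / b) *\<^sub>R y + (1 / a - 1 / b) *\<^sub>R f p) ` f ` G)"
      by (rule hausdorff_close_mono)
    moreover have "(\<lambda>x. (1 / a) *\<^sub>R x) ` f ` K' = (\<lambda>x. (1 / diameter (f ` K)) *\<^sub>R x) ` f ` K"
      unfolding a_def fK'
      using normalized_scaleR_image[OF bounded_linear_image[OF K(1) f(1)], of "1 / diameter K"] K(2)
      by simp
    ultimately show "hausdorff_close (3 * M * \<epsilon> / m) ((\<lambda>x. (1 / diameter (f ` K)) *\<^sub>R x) ` f ` K)
        (f ` (\<lambda>x. (1 / b) *\<^sub>R x + (1 / a - 1 / b) *\<^sub>R p) ` G)"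
      unfolding linear_image_affine_image[OF lin] by (simp add: linear_scale[OF lin])
  qed
qed

lemma large_approxE:
  assumes "\<Gamma> \<in> homothety_types" "compact K" "large_approx s \<Gamma> K" "s > 0"
  obtains G p where "G \<in> \<Gamma>" "bounded G" "p \<in> G" "diameter G = 1" "diameter K > s"
    "hausdorff_close (1 / s) ((\<lambda>x. (1 / diameter K) *\<^sub>R x) ` K) G"
proof -
  obtain S where "\<Gamma> = homothety_class S" "compact S"
    using assms(1) unfolding homothety_types_def by blast
  obtain G where G: "G \<in> \<Gamma>" "diameter G = 1" "diameter K > s"
    and "hausdorff_dist ((\<lambda>x. (1 / diameter K) *\<^sub>R x) ` K) G < 1 / s"
    using assms(3) unfolding large_approx_def by blast
  moreover have "bounded G"
    using compact_homothety_class G(1) \<open>compact S\<close> \<open>\<Gamma> = homothety_class S\<close> compact_imp_bounded by blast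
  moreover obtain p where "p \<in> G" using G(2) by fastforce
  moreover have "K \<noteq> {}" using G(3) assms(4) by auto
  ultimately show ?thesis
    using that hausdorff_close_if_hausdorff_dist_less[of "(\<lambda>x. (1 / diameter K) *\<^sub>R x) ` K" G]
      bounded_scaling compact_imp_bounded[OF assms(2)] by blast
qed

lemma large_approx_matrix_image:
  fixes A :: "real^2^2"
  assumes A: "M-lipschitz_on UNIV ((*v) A)" "m > 0" "\<And>x y. m * dist x y \<le> dist (A *v x) (A *v y)"
    and s: "r > 0" "s \<ge> (3 * M + 1) * r / m"
    and \<Gamma>: "\<Gamma> \<in> homothety_types" and K: "compact K" "large_approx s \<Gamma> K"
  shows "large_approx r (type_image A \<Gamma>) ((*v) A ` K)"
proof -
  have "M \<ge> 0" using A(1) by (rule lipschitz_on_nonneg)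
  then have "(3 * M + 1) * r / m > 0" using s(1) A(2) by simp
  then have "s > 0" using s(2) by linarith
  have "s * m \<ge> (3 * M + 1) * r" using s(2) A(2) by (simp add: pos_divide_le_eq)
  moreover have "(3 * M + 1) * r = 3 * M * r + r" by (simp add: algebra_simps)
  ultimately have sm: "m * s \<ge> 3 * M * r + r" by (simp add: mult.commute)
  then have bound: "3 * M * (1 / s) / m < 1 / r"
    using \<open>s > 0\<close> A(2) s(1) by (simp add: field_simps)
  obtain G p where G: "G \<in> \<Gamma>" "bounded G" "p \<in> G" "diameter G = 1" and "diameter K > s"
    and close_K: "hausdorff_close (1 / s) ((\<lambda>x. (1 / diameter K) *\<^sub>R x) ` K) G"
    using large_approxE[OF \<Gamma> K \<open>s > 0\<close>] by blast
  have "bounded K" using K(1) by (rule compact_imp_bounded)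
  have "diameter K > 0" "K \<noteq> {}" using \<open>diameter K > s\<close> \<open>s > 0\<close> by auto
  obtain c w where "c > 0" and diam: "diameter ((*v) A ` (\<lambda>x. c *\<^sub>R x + w) ` G) = 1"
    and close: "hausdorff_close (3 * M * (1 / s) / m)
       ((\<lambda>x. (1 / diameter ((*v) A ` K)) *\<^sub>R x) ` (*v) A ` K) ((*v) A ` (\<lambda>x. c *\<^sub>R x + w) ` G)"
    by (rule linear_image_normalized_close[OF matrix_vector_mul_bounded_linear A
        \<open>bounded K\<close> \<open>diameter K > 0\<close> G(2-4) close_K])
  have "(*v) A ` (\<lambda>x. c *\<^sub>R x + w) ` G \<in> type_image A \<Gamma>"
    using homothety_class_affine_image[OF _ \<open>c > 0\<close>] G(1) \<Gamma>
    unfolding type_image_def homothety_types_def by blast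
  moreover have "hausdorff_dist ((\<lambda>x. (1 / diameter ((*v) A ` K)) *\<^sub>R x) ` (*v) A ` K)
      ((*v) A ` (\<lambda>x. c *\<^sub>R x + w) ` G) < 1 / r"
    using hausdorff_dist_le[OF _ _ close] \<open>K \<noteq> {}\<close> \<open>p \<in> G\<close> bound by fastforce
  moreover have "diameter ((*v) A ` K) > r"
  proof -
    have "m * diameter K \<le> diameter ((*v) A ` K)"
      using diameter_image_ge[OF bounded_linear_image[OF \<open>bounded K\<close>] A(2,3)] by simp
    moreover have "m * diameter K > m * s"
      using \<open>diameter K > s\<close> A(2) by (rule mult_strict_left_mono)
    moreover have "3 * M * r \<ge> 0" using \<open>M \<ge> 0\<close> s(1) by simp
    ultimately show ?thesis using sm by linarith
  qed
  ultimately show ?thesis unfolding large_approx_def using diam by blast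
qed

theorem mainTheorem6:
  fixes r :: real and A :: "real^2^2"
  assumes "r > 0" and "invertible A"
  shows "\<exists>s0. \<forall>s\<ge>s0. \<forall>\<Gamma>\<in>homothety_types. \<forall>K::(real^2) set.
           K \<noteq> {} \<and> compact K \<and> large_approx s \<Gamma> K \<longrightarrow>
           large_approx r (type_image A \<Gamma>) ((\<lambda>x. A *v x) ` K)"
proof -
  obtain M where M: "M-lipschitz_on UNIV ((*v) A)"
    using bounded_linear.lipschitz_boundE[OF matrix_vector_mul_bounded_linear] by blast
  obtain A' where "A' ** A = mat 1" using assms(2) unfolding invertible_def by blast
  then have "(*v) A' \<circ> (*v) A = id" by (auto simp: matrix_vector_mul_assoc)
  then obtain m where "m > 0" and "\<And>x. m * norm x \<le> norm (A *v x)"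
    using linear_invertible_bounded_below_pos[OF matrix_vector_mul_linear matrix_vector_mul_linear] by blast
  then have "m * dist x y \<le> dist (A *v x) (A *v y)" for x y
    by (metis dist_norm matrix_vector_mult_diff_distrib)
  then show ?thesis
    using large_approx_matrix_image[OF M \<open>m > 0\<close> _ assms(1)]
    by (intro exI[of _ "(3 * M + 1) * r / m"] allI impI ballI) blast
qed

end
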